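(* Let $(X,d)$ be a compact metric space and let $G$ be the semigroup generated by a finite set $F=\{f_1,f_2,\ldots,f_p\}$ of continuous maps from $X$ to itself. Then $$h_H(G,F)\leq h(G,F),$$ where $h_H(G,F)$ is the Hausdorff metric entropy and $h(G,F)$ is Biś's topological entropy of the semigroup.
   Context: Compact metric spaces are non-empty, and $p\ge 1$. Put $F^0=\{\mathrm{id}_X\}$ and, for $n\ge 1$, $F^n=\{g_n\circ g_{n-1}\circ\cdots\circ g_1 : g_j\in\{f_1,\ldots,f_p\} \text{ for all } 1\le j\le n\}$. For $x\in X$ and $n\ge 0$ put $F^n(x)=\{g(x): g\in F^n\}$, a non-empty finite (hence compact) subset of $X$. For non-empty compact $A,B\subseteq X$ the Hausdorff metric is $d_H(A,B)=\max\{\sup_{a\in A}\inf_{b\in B}d(a,b),\ \sup_{b\in B}\inf_{a\in A}d(a,b)\}$. Hausdorff metric entropy. For $x,y\in X$ and $n\ge 0$ put $d_H^n(x,y)=\max_{0\le i\le n} d_H(F^i(x),F^i(y))$. For $\epsilon>0$, a subset $M\subseteq X$ is a Hausdorff metric $(n,\epsilon)$-spanning set of $X$ with respect to $F$ if for each $x\in X$ there is $y\in M$ with $d_H^n(x,y)<\epsilon$. Let $r_H(n,\epsilon,X,F)$ be the minimal cardinality of such a set (a finite positive integer). Define $$h_H(G,F)=\lim_{\epsilon\to 0^+}\limsup_{n\to+\infty}\frac1n\log r_H(n,\epsilon,X,F)\in[-\infty,+\infty].$$ Biś's topological entropy. For $k\ge 0$ put $d^k(x,y)=\max\{d(g(x),g(y)):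 g\in F^k\}$, and put $d_{max}^n(x,y)=\max\{d^k(x,y): 0\le k\le n\}$. A subset $A\subseteq X$ is $(n,\epsilon)$-separated if $d_{max}^n(x,y)\ge\epsilon$ for any two distinct points $x,y\in A$. Let $s(n,\epsilon,X)$ be the maximal cardinality of an $(n,\epsilon)$-separated subset of $X$. Define $$h(G,F)=\lim_{\epsilon\to 0^+}\limsup_{n\to+\infty}\frac1n\log s(n,\epsilon,X).$$ *)

theory Defs
  imports "HOL-Analysis.Analysis"
begin

text \<open>
  The space is a set \<open>X\<close> in a metric space type, and maps of \<open>X\<close> are functions on the type that
  send \<open>X\<close> to \<open>X\<close>; only their values on \<open>X\<close> matter below. Both entropies of the semigroup
  generated by \<open>F\<close> are defined through the generating set \<open>F\<close> alone, so the semigroup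
  is not carried as an extra argument.
\<close>

primrec words :: "('a \<Rightarrow> 'a) set \<Rightarrow> nat \<Rightarrow> ('a \<Rightarrow> 'a) set" where
  "words F 0 = {id}"
| "words F (Suc n) = {f \<circ> g | f g. f \<in> F \<and> g \<in> words F n}"

definition orbit_set :: "('a \<Rightarrow> 'a) set \<Rightarrow> nat \<Rightarrow> 'a \<Rightarrow> 'a set" where
  "orbit_set F n x = {g x | g. g \<in> words F n}"

definition hausdorff_dist :: "'a::metric_space set \<Rightarrow> 'a set \<Rightarrow> real" where
  "hausdorff_dist A B =
     max (SUP a\<in>A. INF b\<in>B. dist a b) (SUP b\<in>B. INF a\<in>A. dist a b)"


subsection \<open>Hausdorff metric entropy\<close>

definition dH :: "('a::metric_space \<Rightarrow> 'a) set \<Rightarrow> nat \<Rightarrow> 'a \<Rightarrow> 'a \<Rightarrow> real" where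
  "dH F n x y = (MAX i\<in>{0..n}. hausdorff_dist (orbit_set F i x) (orbit_set F i y))"

definition hausdorff_spanning ::
  "'a::metric_space set \<Rightarrow> ('a \<Rightarrow> 'a) set \<Rightarrow> nat \<Rightarrow> real \<Rightarrow> 'a set \<Rightarrow> bool" where
  "hausdorff_spanning X F n \<epsilon> M \<longleftrightarrow> M \<subseteq> X \<and> (\<forall>x\<in>X. \<exists>y\<in>M. dH F n x y < \<epsilon>)"

text \<open>
  The conjunct \<^term>\<open>finite M\<close> keeps infinite spanning sets, whose \<^const>\<open>card\<close> is \<open>0\<close>, out of the
  minimum; likewise for the maximum in \<open>s_sep\<close>. For compact \<open>X\<close>, finitely many continuous
  maps and \<open>\<epsilon> > 0\<close> both extrema are attained.
\<close>

definition r_H :: "nat \<Rightarrow> real \<Rightarrow> 'a::metric_space set \<Rightarrow> ('a \<Rightarrow> 'a) set \<Rightarrow> nat" where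
  "r_H n \<epsilon> X F = (LEAST k. \<exists>M. hausdorff_spanning X F n \<epsilon> M \<and> finite M \<and> card M = k)"

definition hausdorff_metric_entropy :: "'a::metric_space set \<Rightarrow> ('a \<Rightarrow> 'a) set \<Rightarrow> ereal" where
  "hausdorff_metric_entropy X F =
     Lim (at_right 0) (\<lambda>\<epsilon>::real. limsup (\<lambda>n. ereal (1 / real n * ln (real (r_H n \<epsilon> X F)))))"


subsection \<open>Topological entropy\<close>

definition d_word :: "('a::metric_space \<Rightarrow> 'a) set \<Rightarrow> nat \<Rightarrow> 'a \<Rightarrow> 'a \<Rightarrow> real" where
  "d_word F k x y = (MAX g\<in>words F k. dist (g x) (g y))"

definition d_max :: "('a::metric_space \<Rightarrow> 'a) set \<Rightarrow> nat \<Rightarrow> 'a \<Rightarrow> 'a \<Rightarrow> real" where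
  "d_max F n x y = (MAX k\<in>{0..n}. d_word F k x y)"

definition separated ::
  "'a::metric_space set \<Rightarrow> ('a \<Rightarrow> 'a) set \<Rightarrow> nat \<Rightarrow> real \<Rightarrow> 'a set \<Rightarrow> bool" where
  "separated X F n \<epsilon> A \<longleftrightarrow> A \<subseteq> X \<and> (\<forall>x\<in>A. \<forall>y\<in>A. x \<noteq> y \<longrightarrow> d_max F n x y \<ge> \<epsilon>)"

definition s_sep :: "nat \<Rightarrow> real \<Rightarrow> 'a::metric_space set \<Rightarrow> ('a \<Rightarrow> 'a) set \<Rightarrow> nat" where
  "s_sep n \<epsilon> X F = (GREATEST k. \<exists>A. separated X F n \<epsilon> A \<and> finite A \<and> card A = k)"

definition bis_entropy :: "'a::metric_space set \<Rightarrow> ('a \<Rightarrow> 'a) set \<Rightarrow> ereal" where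
  "bis_entropy X F =
     Lim (at_right 0) (\<lambda>\<epsilon>::real. limsup (\<lambda>n. ereal (1 / real n * ln (real (s_sep n \<epsilon> X F)))))"

end

theory Submission
  imports Defs
begin

text \<open>
  The distance between \<open>g x\<close> and \<open>g y\<close> for the same word \<open>g\<close> bounds the distance from \<open>g x\<close> to the
  whole orbit set of \<open>y\<close>, so \<open>dH \<le> d_max\<close>. A separated set of maximal cardinality is spanning for
  \<open>d_max\<close>, hence also for \<open>dH\<close>, which gives \<open>r_H \<le> s_sep\<close> for all \<open>n\<close> and all \<open>\<epsilon> > 0\<close>. Both growth
  rates are antitone in \<open>\<epsilon>\<close>, so the limits as \<open>\<epsilon> \<rightarrow> 0\<close> exist and inherit the inequality.
\<close>

lemma finite_words: "finite F \<Longrightarrow> finite (words F n)"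
proof (induction n)
  case (Suc n)
  have "words F (Suc n) = (\<lambda>(f, g). f \<circ> g) ` (F \<times> words F n)"
    by auto
  with Suc show ?case
    by simp
qed simp

lemma words_nonempty: "F \<noteq> {} \<Longrightarrow> words F n \<noteq> {}"
  by (induction n) auto

text \<open>Invariance of \<open>X\<close> joins the induction because the outer map
  \<open>f\<close> is continuous only on \<open>X\<close>, so the inner word must land
  there.\<close>

lemma words_continuous_on:
  assumes cont: "\<forall>f\<in>F. continuous_on X f"
    and maps: "\<forall>f\<in>F. f ` X \<subseteq> X"
  shows "g \<in> words F n \<Longrightarrow> continuous_on X g \<and> g ` X \<subseteq> X"
proof (induction n arbitrary: g)
  case (Suc n)
  then obtain f h where g: "g = f \<circ> h" and "f \<in> F" "h \<in> words F n"
    by auto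
  with Suc.IH have h: "continuous_on X h" "h ` X \<subseteq> X"
    by blast+
  have "continuous_on X g"
    unfolding g using h cont \<open>f \<in> F\<close> by (blast intro: continuous_on_compose continuous_on_subset)
  moreover have "g ` X \<subseteq> X"
    unfolding g using h maps \<open>f \<in> F\<close> by auto
  ultimately show ?case ..
qed simp

lemma hausdorff_dist_image_le:
  assumes "W \<noteq> {}" and le: "\<And>g. g \<in> W \<Longrightarrow> dist (g x) (g y) \<le> c"
  shows "hausdorff_dist {g x | g. g \<in> W} {g y | g. g \<in> W} \<le> c"
proof -
  \<comment> \<open>A real infimum is bounded by a single value only if the family is bounded below;
    0 serves for distances. The two forms match the two argument orders in
    \<open>hausdorff_dist\<close>.\<close>
  have bdd: "bdd_below (dist a ` B)" "bdd_below ((\<lambda>b. dist b a) ` B)" for a :: 'b and B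
    by (auto intro: bdd_belowI2[where m = 0])
  have "(SUP a\<in>{g x | g. g \<in> W}. INF b\<in>{g y | g. g \<in> W}. dist a b) \<le> c"
    using assms by (intro cSUP_least) (auto intro!: cINF_lower2[OF bdd(1)])
  moreover have "(SUP b\<in>{g y | g. g \<in> W}. INF a\<in>{g x | g. g \<in> W}. dist a b) \<le> c"
    using assms by (intro cSUP_least) (auto intro!: cINF_lower2[OF bdd(2)])
  ultimately show ?thesis
    by (simp add: hausdorff_dist_def)
qed

lemma d_max_commute: "d_max F n x y = d_max F n y x"
  by (simp add: d_max_def d_word_def dist_commute)

text \<open>Both maxima range over finite non-empty sets, so the nested maxima flatten to one
  condition on all words of length at most \<open>n\<close>.\<close>

lemma d_max_less_iff:
  assumes "finite F" "F \<noteq> {}"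
  shows "d_max F n x y < e \<longleftrightarrow> (\<forall>g\<in>(\<Union>k\<le>n. words F k). dist (g x) (g y) < e)"
  using assms by (auto simp: d_max_def d_word_def finite_words words_nonempty)

lemma dH_le_d_max:
  assumes "finite F" "F \<noteq> {}"
  shows "dH F n x y \<le> d_max F n x y"
proof -
  have "hausdorff_dist (orbit_set F i x) (orbit_set F i y) \<le> d_max F n x y" if "i \<le> n" for i
  proof -
    have "hausdorff_dist (orbit_set F i x) (orbit_set F i y) \<le> d_word F i x y"
      unfolding orbit_set_def d_word_def using assms
      by (intro hausdorff_dist_image_le) (auto simp: words_nonempty finite_words)
    also have "\<dots> \<le> d_max F n x y"
      unfolding d_max_def using that by (intro Max_ge) auto
    finally show ?thesis .
  qed
  then show ?thesis
    unfolding dH_def by (subst Max_le_iff) auto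
qed

text \<open>Heine-Cantor gives a modulus for each map, and the minimum of finitely many positive
  moduli is positive.\<close>

lemma finite_uniformly_equicontinuous:
  assumes "compact X" "finite W" "\<And>g. g \<in> W \<Longrightarrow> continuous_on X g" "0 < e"
  shows "\<exists>d>0. \<forall>g\<in>W. \<forall>x\<in>X. \<forall>y\<in>X. dist x y < d \<longrightarrow> dist (g x) (g y) < e"
  using assms(2,3)
proof (induction W rule: finite_induct)
  case empty
  show ?case
    by (auto intro: exI[of _ 1])
next
  case (insert g W)
  then obtain d where d: "d > 0" "\<forall>g\<in>W. \<forall>x\<in>X. \<forall>y\<in>X. dist x y < d \<longrightarrow> dist (g x) (g y) < e"
    by auto
  have "uniformly_continuous_on X g"
    using insert.prems assms(1) by (simp add: compact_uniformly_continuous)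
  then obtain d' where d': "d' > 0" "\<forall>x\<in>X. \<forall>y\<in>X. dist x y < d' \<longrightarrow> dist (g x) (g y) < e"
    using \<open>0 < e\<close> unfolding uniformly_continuous_on_def by (metis dist_commute)
  show ?case
    using d d' by (intro exI[of _ "min d d'"]) auto
qed

text \<open>Pigeonhole: points closer than a common modulus \<open>d\<close> for all words of length
  at most \<open>n\<close> cannot both lie in a separated set, so each ball of a finite cover by
  radius \<open>d / 2\<close> holds at most one of them. The number of balls does not depend on the
  set.\<close>

lemma separated_card_bounded:
  assumes "compact X" "finite F" "F \<noteq> {}"
    and "\<forall>f\<in>F. continuous_on X f" "\<forall>f\<in>F. f ` X \<subseteq> X" "0 < e"
  shows "\<exists>b. \<forall>A. separated X F n e A \<longrightarrow> card A \<le> b"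
proof -
  define W where "W = (\<Union>k\<le>n. words F k)"
  have "finite W"
    unfolding W_def using assms(2) by (simp add: finite_words)
  moreover have "continuous_on X g" if "g \<in> W" for g
    using that words_continuous_on[OF assms(4,5)] unfolding W_def by blast
  ultimately have "\<exists>d>0. \<forall>g\<in>W. \<forall>x\<in>X. \<forall>y\<in>X. dist x y < d \<longrightarrow> dist (g x) (g y) < e"
    by (rule finite_uniformly_equicontinuous[OF assms(1) _ _ assms(6)])
  then obtain d where "d > 0"
    and d: "\<forall>g\<in>W. \<forall>x\<in>X. \<forall>y\<in>X. dist x y < d \<longrightarrow> dist (g x) (g y) < e"
    by blast
  have "X \<subseteq> (\<Union>x\<in>X. ball x (d / 2))"
    using \<open>d > 0\<close> by auto
  then obtain C where "C \<subseteq> X" and C: "finite C" "X \<subseteq> (\<Union>x\<in>C. ball x (d / 2))"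
    by (rule compactE_image[OF assms(1) open_ball])
  have "card A \<le> card C" if A: "separated X F n e A" for A
  proof -
    have "\<exists>c\<in>C. dist c a < d / 2" if "a \<in> A" for a
      using that A C by (force simp: separated_def)
    then obtain c where c: "\<And>a. a \<in> A \<Longrightarrow> c a \<in> C \<and> dist (c a) a < d / 2"
      by metis
    have "inj_on c A"
    proof (rule inj_onI, rule ccontr)
      fix x y assume xy: "x \<in> A" "y \<in> A" "c x = c y" "x \<noteq> y"
      have "dist x y < d"
        using c[OF xy(1)] c[OF xy(2)] xy(3) by (metis dist_triangle_half_r)
      then have "d_max F n x y < e"
        unfolding d_max_less_iff[OF assms(2,3)] W_def[symmetric]
        using d xy A by (auto simp: separated_def)
      then show False
        using A xy by (force simp: separated_def)
    qed
    then show ?thesis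
      using c C(1) by (auto intro: card_inj_on_le)
  qed
  then show ?thesis
    by blast
qed

text \<open>\<open>GREATEST\<close> is meaningful once the attainable cardinalities are bounded and
  at least one exists; the empty set provides 0.\<close>

lemma s_sep_attained:
  assumes "\<exists>b. \<forall>A. separated X F n e A \<longrightarrow> card A \<le> b"
  shows "\<exists>A. separated X F n e A \<and> finite A \<and> card A = s_sep n e X F"
    and "\<And>A. separated X F n e A \<Longrightarrow> finite A \<Longrightarrow> card A \<le> s_sep n e X F"
proof -
  obtain b where b: "\<And>A. separated X F n e A \<Longrightarrow> card A \<le> b"
    using assms by blast
  let ?P = "\<lambda>k. \<exists>A. separated X F n e A \<and> finite A \<and> card A = k"
  have le: "k \<le> b" if "?P k" for k
    using that b by auto
  have "?P 0"
    by (intro exI[of _ "{}"]) (simp add: separated_def)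
  then show "?P (s_sep n e X F)"
    unfolding s_sep_def by (rule GreatestI_nat[where P = ?P]) (rule le)
  show "card A \<le> s_sep n e X F" if "separated X F n e A" "finite A" for A
    unfolding s_sep_def by (rule Greatest_le_nat[where P = ?P and b = b]) (use that le in auto)
qed

text \<open>A point at \<open>d_max\<close> distance at least \<open>e\<close> from all of
  \<open>A\<close> could be added to \<open>A\<close>, contradicting maximality.\<close>

lemma maximal_separated_spanning:
  assumes "finite F" "F \<noteq> {}" "0 < e" and A: "separated X F n e A" "finite A"
    and max: "\<And>B. separated X F n e B \<Longrightarrow> finite B \<Longrightarrow> card B \<le> card A"
  shows "hausdorff_spanning X F n e A"
proof -
  have "\<exists>y\<in>A. d_max F n x y < e" if "x \<in> X" for x
  proof (cases "x \<in> A")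
    case True
    then show ?thesis
      using assms(1-3) by (intro bexI[of _ x]) (simp_all add: d_max_less_iff)
  next
    case False
    show ?thesis
    proof (rule ccontr)
      assume "\<not> ?thesis"
      \<comment> \<open>\<open>separated\<close> quantifies over ordered pairs, so both orders are
        needed for the enlarged set.\<close>
      then have "e \<le> d_max F n x y" "e \<le> d_max F n y x" if "y \<in> A" for y
        using that by (auto simp: not_less d_max_commute[of F n y])
      then have "separated X F n e (insert x A)"
        using A(1) \<open>x \<in> X\<close> unfolding separated_def by blast
      then show False
        using max[of "insert x A"] A False by simp
    qed
  qed
  then have "\<forall>x\<in>X. \<exists>y\<in>A. dH F n x y < e"
    by (meson dH_le_d_max[OF assms(1,2)] le_less_trans)
  then show ?thesis
    using A by (auto simp: hausdorff_spanning_def separated_def)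
qed

lemma r_H_le_card: "hausdorff_spanning X F n e M \<Longrightarrow> finite M \<Longrightarrow> r_H n e X F \<le> card M"
  unfolding r_H_def by (rule Least_le) blast

lemma r_H_attained:
  assumes "hausdorff_spanning X F n e M" "finite M"
  shows "\<exists>N. hausdorff_spanning X F n e N \<and> finite N \<and> card N = r_H n e X F"
  unfolding r_H_def by (rule LeastI[where k = "card M"]) (use assms in blast)

text \<open>The terms may be \<open>0\<close>, since \<open>ln 0 = 0\<close> in the library.\<close>

lemma limsup_growth_mono:
  assumes "\<And>n. a n \<le> (b n :: nat)"
  shows "limsup (\<lambda>n. ereal (1 / real n * ln (real (a n))))
    \<le> limsup (\<lambda>n. ereal (1 / real n * ln (real (b n))))"
proof (intro Limsup_mono always_eventually allI)
  fix n
  have "ln (real (a n)) \<le> ln (real (b n))"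
    \<comment> \<open>If \<open>a n = 0\<close>, the left side is 0 and the right side is 0 or the
      logarithm of an integer at least 1.\<close>
    using assms[of n] by (cases "a n = 0"; cases "b n = 0") auto
  then show "ereal (1 / real n * ln (real (a n))) \<le> ereal (1 / real n * ln (real (b n)))"
    by (simp add: divide_right_mono)
qed

text \<open>The limit is the supremum over all points right of \<open>a\<close>, which always exists
  in \<open>ereal\<close>. Convergence has to be established before anything can be inferred about
  the value of \<open>Lim\<close>.\<close>

lemma antimono_tendsto_Lim_at_right:
  fixes f :: "real \<Rightarrow> ereal"
  assumes anti: "\<And>x y. a < x \<Longrightarrow> x \<le> y \<Longrightarrow> f y \<le> f x"
  shows "(f \<longlongrightarrow> Lim (at_right a) f) (at_right a)"
proof -
  have "(f \<longlongrightarrow> (SUP x\<in>{a<..}. f x)) (at_right a)"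
  proof (rule increasing_tendsto)
    show "\<forall>\<^sub>F x in at_right a. f x \<le> (SUP x\<in>{a<..}. f x)"
      by (auto simp: eventually_at_filter intro!: always_eventually SUP_upper)
  next
    fix l assume "l < (SUP x\<in>{a<..}. f x)"
    then obtain y where y: "a < y" "l < f y"
      by (auto simp: less_SUP_iff)
    \<comment> \<open>A single \<open>y\<close> with \<open>l < f y\<close> suffices: every
      \<open>x\<close> between \<open>a\<close> and \<open>y\<close> has \<open>f x\<close> at least
      \<open>f y\<close>.\<close>
    then show "\<forall>\<^sub>F x in at_right a. l < f x"
      unfolding eventually_at_right_field
      by (intro exI[of _ y]) (meson anti less_imp_le less_le_trans)
  qed
  then show ?thesis
    using tendsto_Lim[OF trivial_limit_at_right_real] by metis
qed

theorem proposition4p2: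
  fixes X :: "'a::metric_space set" and F :: "('a \<Rightarrow> 'a) set"
  assumes "compact X" and "X \<noteq> {}"
    and "finite F" and "F \<noteq> {}"
    and "\<And>f. f \<in> F \<Longrightarrow> continuous_on X f"
    and "\<And>f. f \<in> F \<Longrightarrow> f ` X \<subseteq> X"
  shows "hausdorff_metric_entropy X F \<le> bis_entropy X F"
proof -
  define R where
    "R = (\<lambda>\<epsilon>::real. limsup (\<lambda>n. ereal (1 / real n * ln (real (r_H n \<epsilon> X F)))))"
  define S where
    "S = (\<lambda>\<epsilon>::real. limsup (\<lambda>n. ereal (1 / real n * ln (real (s_sep n \<epsilon> X F)))))"
  have "\<forall>f\<in>F. continuous_on X f" "\<forall>f\<in>F. f ` X \<subseteq> X"
    using assms(5,6) by blast+
  note sep = s_sep_attained[OF separated_card_bounded[OF assms(1,3,4) this]]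
  \<comment> \<open>This is used twice: it bounds \<open>r_H\<close> by \<open>s_sep\<close>, and it
    supplies the finite spanning set without which the minimum in \<open>r_H\<close> need not be
    attained.\<close>
  have span: "\<exists>M. hausdorff_spanning X F n e M \<and> finite M \<and> card M = s_sep n e X F"
    if "0 < e" for n e
    using sep[OF that, of n] maximal_separated_spanning[OF assms(3,4) that] by metis
  have "r_H n e X F \<le> s_sep n e X F" if "0 < e" for n e
    using span[OF that, of n] r_H_le_card by metis
  then have "R e \<le> S e" if "0 < e" for e
    unfolding R_def S_def using that by (intro limsup_growth_mono)
  then have le: "\<forall>\<^sub>F e in at_right 0. R e \<le> S e"
    by (simp add: eventually_at_filter)
  \<comment> \<open>A minimal spanning set at the finer scale \<open>e\<close> also spans at the
    coarser scale \<open>e'\<close>.\<close>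
  have "r_H n e' X F \<le> r_H n e X F" if e: "0 < e" "e \<le> e'" for n e e'
  proof -
    obtain N where N: "hausdorff_spanning X F n e N" "finite N" "card N = r_H n e X F"
      using span[OF e(1), of n] by (blast dest: r_H_attained)
    then have "hausdorff_spanning X F n e' N"
      using e(2) by (force simp: hausdorff_spanning_def)
    then show ?thesis
      using N r_H_le_card by metis
  qed
  then have "R e' \<le> R e" if "0 < e" "e \<le> e'" for e e'
    unfolding R_def using that by (intro limsup_growth_mono)
  then have R: "(R \<longlongrightarrow> Lim (at_right 0) R) (at_right 0)"
    by (rule antimono_tendsto_Lim_at_right)
  \<comment> \<open>Here the transfer goes the other way: a maximal set separated at
    \<open>e'\<close> stays separated at the smaller \<open>e\<close>.\<close>
  have "s_sep n e' X F \<le> s_sep n e X F" if "0 < e" "e \<le> e'" for n e e'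
  proof -
    have "0 < e'"
      using that by simp
    then obtain A where A: "separated X F n e' A" "finite A" "card A = s_sep n e' X F"
      using sep(1) by blast
    then have "separated X F n e A"
      using that by (force simp: separated_def)
    then show ?thesis
      using A sep(2) that(1) by metis
  qed
  then have "S e' \<le> S e" if "0 < e" "e \<le> e'" for e e'
    unfolding S_def using that by (intro limsup_growth_mono)
  then have S: "(S \<longlongrightarrow> Lim (at_right 0) S) (at_right 0)"
    by (rule antimono_tendsto_Lim_at_right)
  have "Lim (at_right 0) R \<le> Lim (at_right 0) S"
    by (rule tendsto_le[OF trivial_limit_at_right_real S R le])
  then show ?thesis
    by (simp add: hausdorff_metric_entropy_def bis_entropy_def R_def S_def)
qed

end
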